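(* Let $K$ be a totally real number field with Galois closure $L$ (over $\mathbb{Q}$). If $f \in \mathbb{Q}[x_1,\ldots,x_n]$ is a sum of $m$ squares in $K[x_1,\ldots,x_n]$, then $f$ is a sum of $$4m \cdot 2^{[L:\mathbb{Q}]+1} \binom{[L:\mathbb{Q}]+1}{2}$$ squares in $\mathbb{Q}[x_1,\ldots,x_n]$.
   Context: A totally real number field is a finite algebraic extension of $\mathbb{Q}$ all of whose complex embeddings have image contained in $\mathbb{R}$. An element $f$ is a sum of $N$ squares in a commutative ring $A$ if $f=\sum_{i=1}^N p_i^2$ with $p_i\in A$ (the $p_i$ may be zero). *)

theory Defs
  imports
    Complex_Main
    "HOL-Library.Poly_Mapping"
    "HOL-Computational_Algebra.Polynomial"
begin

(* Number fields are subsets of an ambient field 'a of characteristic 0, which is arbitrary: it may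
   be the number field itself, its Galois closure, or the complex numbers.  The prime field is the
   range of of_rat, and 'a is a rational vector space via of_rat. *)

global_interpretation rat_vec:
  vector_space "\<lambda>(q::rat) (x::'a::field_char_0). of_rat q * x"
  by unfold_locales (simp_all add: algebra_simps of_rat_add of_rat_mult)

(* inverse 0 = 0, so there is no need to exclude 0 in the last clause *)
definition is_subfield :: "'a::field set \<Rightarrow> bool" where
  "is_subfield F \<longleftrightarrow>
     0 \<in> F \<and> 1 \<in> F \<and>
     (\<forall>x\<in>F. \<forall>y\<in>F. x + y \<in> F \<and> x * y \<in> F) \<and>
     (\<forall>x\<in>F. - x \<in> F \<and> inverse x \<in> F)"

definition is_number_field :: "'a::field_char_0 set \<Rightarrow> bool" where
  "is_number_field F \<longleftrightarrow> is_subfield F \<and> (\<exists>B. finite B \<and> rat_vec.span B = F)"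

(* [F:Q]; the library sets dim to 0 for infinite-dimensional spaces, so this is only meaningful
   when F is a number field *)
definition degree_over_rat :: "'a::field_char_0 set \<Rightarrow> nat" where
  "degree_over_rat F = rat_vec.dim F"

definition complex_embedding :: "'a::field set \<Rightarrow> ('a \<Rightarrow> complex) \<Rightarrow> bool" where
  "complex_embedding F \<sigma> \<longleftrightarrow>
     \<sigma> 1 = 1 \<and> (\<forall>x\<in>F. \<forall>y\<in>F. \<sigma> (x + y) = \<sigma> x + \<sigma> y \<and> \<sigma> (x * y) = \<sigma> x * \<sigma> y)"

definition totally_real_number_field :: "'a::field_char_0 set \<Rightarrow> bool" where
  "totally_real_number_field F \<longleftrightarrow>
     is_number_field F \<and> (\<forall>\<sigma>. complex_embedding F \<sigma> \<longrightarrow> \<sigma> ` F \<subseteq> \<real>)"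

(* Finite Galois extensions of Q: every irreducible rational polynomial with a root in F is a
   constant times a product of linear factors over F (normality), and these factors are pairwise
   distinct (separability). *)
definition is_galois_over_rat :: "'a::field_char_0 set \<Rightarrow> bool" where
  "is_galois_over_rat F \<longleftrightarrow>
     is_number_field F \<and>
     (\<forall>p :: rat poly. irreducible p \<and> (\<exists>x\<in>F. poly (map_poly of_rat p) x = 0) \<longrightarrow>
        (\<exists>A\<subseteq>F. finite A \<and>
           map_poly of_rat p = smult (of_rat (lead_coeff p)) (\<Prod>a\<in>A. [:- a, 1:])))"

definition is_galois_closure :: "'a::field_char_0 set \<Rightarrow> 'a set \<Rightarrow> bool" where
  "is_galois_closure K L \<longleftrightarrow>
     is_galois_over_rat L \<and> K \<subseteq> L \<and>
     (\<forall>M. is_galois_over_rat M \<and> K \<subseteq> M \<and> M \<subseteq> L \<longrightarrow> M = L)"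

(* R[x_1,...,x_n] for R a subset of 'a: a polynomial is a finitely supported family of coefficients
   indexed by monomials, and a monomial is a finitely supported family of exponents indexed by the
   variables, here numbered 1,...,n. *)
definition polys_in :: "nat \<Rightarrow> 'a::zero set \<Rightarrow> ((nat \<Rightarrow>\<^sub>0 nat) \<Rightarrow>\<^sub>0 'a) set" where
  "polys_in n R =
     {p. range (Poly_Mapping.lookup p) \<subseteq> R \<and>
         (\<forall>t \<in> Poly_Mapping.keys p. Poly_Mapping.keys t \<subseteq> {1..n})}"

definition rat_poly_to :: "((nat \<Rightarrow>\<^sub>0 nat) \<Rightarrow>\<^sub>0 rat) \<Rightarrow> ((nat \<Rightarrow>\<^sub>0 nat) \<Rightarrow>\<^sub>0 'a::field_char_0)" where
  "rat_poly_to f = Poly_Mapping.map of_rat f"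

definition sum_of_squares_in :: "'r::comm_ring_1 set \<Rightarrow> nat \<Rightarrow> 'r \<Rightarrow> bool" where
  "sum_of_squares_in A N f \<longleftrightarrow>
     (\<exists>p :: nat \<Rightarrow> 'r. (\<forall>i\<in>{1..N}. p i \<in> A) \<and> f = (\<Sum>i=1..N. (p i)\<^sup>2))"

end

theory Submission
  imports
    Defs
    "HOL-Computational_Algebra.Primes"
    "HOL-Computational_Algebra.Fundamental_Theorem_Algebra"
    "Jordan_Normal_Form.Schur_Decomposition"
begin

text \<open>With \<open>k = [K:\<rat>] \<le> [L:\<rat>]\<close>, already \<open>4 m k\<close> squares suffice.
  If \<open>f = \<Sum> p\<^sub>l\<^sup>2\<close> over \<open>K\<close>, then \<open>k f = \<Sum> Tr (p\<^sub>l\<^sup>2)\<close>, where \<open>Tr\<close> is the trace of \<open>K\<close> over \<open>\<rat>\<close> applied to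
  coefficients. The trace form \<open>x \<mapsto> Tr (x\<^sup>2)\<close> is positive semidefinite because the eigenvalues of
  multiplication by \<open>x\<close> are images of \<open>x\<close> under complex embeddings, hence real. Diagonalizing it over
  \<open>\<rat>\<close> turns each \<open>Tr (p\<^sub>l\<^sup>2)\<close> into \<open>k\<close> squares with nonnegative rational weights, and each weight is a
  sum of four squares.\<close>

section \<open>Rational sums of four squares\<close>

definition four_squares :: "'a::comm_ring_1 \<Rightarrow> bool" where
  "four_squares x \<longleftrightarrow> (\<exists>a b c d. x = a\<^sup>2 + b\<^sup>2 + c\<^sup>2 + d\<^sup>2)"

text \<open>Euler's four-square identity: the norm of quaternions is multiplicative, and the four
  terms are the components of a conjugate product.\<close>

lemma four_squares_mult:
  assumes "four_squares x" "four_squares y"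
  shows "four_squares (x * y)"
proof -
  obtain a b c d where x: "x = a\<^sup>2 + b\<^sup>2 + c\<^sup>2 + d\<^sup>2"
    using assms(1) unfolding four_squares_def by blast
  obtain p q r s where y: "y = p\<^sup>2 + q\<^sup>2 + r\<^sup>2 + s\<^sup>2"
    using assms(2) unfolding four_squares_def by blast
  have "x * y = (a*p + b*q + c*r + d*s)\<^sup>2 + (a*q - b*p + c*s - d*r)\<^sup>2
      + (a*r - b*s - c*p + d*q)\<^sup>2 + (a*s + b*r - c*q - d*p)\<^sup>2"
    unfolding x y by (simp add: power2_eq_square algebra_simps)
  then show ?thesis
    unfolding four_squares_def by blast
qed

lemma four_squares_square: "four_squares (a\<^sup>2)"
  unfolding four_squares_def by (rule exI[of _ a], intro exI[of _ 0], simp)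

text \<open>Dividing by \<open>y\<close> amounts to multiplying by \<open>y\<close> and by the
  square of \<open>1 / y\<close>. For \<open>y = 0\<close> the quotient is 0 by convention.\<close>

lemma four_squares_divide:
  fixes x y :: "'a::field"
  assumes "four_squares x" "four_squares y"
  shows "four_squares (x / y)"
proof (cases "y = 0")
  case True
  then show ?thesis
    using four_squares_square[of "0::'a"] by simp
next
  case False
  then have "x / y = x * y * (1 / y)\<^sup>2"
    by (simp add: power2_eq_square)
  then show ?thesis
    using assms by (metis four_squares_mult four_squares_square)
qed

text \<open>Pigeonhole modulo \<open>p\<close>: the residues of \<open>a\<^sup>2\<close> and of
  \<open>- 1 - b\<^sup>2\<close>, with both variables at most \<open>(p - 1) / 2\<close>, form two
  sets of \<open>(p + 1) / 2\<close> elements each, so the sets meet. The bounds on \<open>a\<close>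
  and \<open>b\<close> keep the cofactor of \<open>p\<close> small later.\<close>

lemma odd_prime_dvd_two_squares_plus_one:
  fixes p :: int
  assumes "prime p" "odd p"
  obtains a b where "0 \<le> a" "2 * a < p" "0 \<le> b" "2 * b < p" "p dvd a\<^sup>2 + b\<^sup>2 + 1"
proof -
  define h where "h = p div 2"
  have p: "p = 2 * h + 1" and h: "0 \<le> h"
    using \<open>odd p\<close> prime_gt_0_int[OF \<open>prime p\<close>] unfolding h_def by presburger+
  \<comment> \<open>For distinct \<open>x\<close>, \<open>y\<close> in \<open>{0..h}\<close>, both
    the absolute difference and the sum lie strictly between 0 and \<open>p\<close>, so the prime
    \<open>p\<close> divides neither factor.\<close>
  have inj: "x = y" if "x \<in> {0..h}" "y \<in> {0..h}" "p dvd x\<^sup>2 - y\<^sup>2" for x y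
  proof -
    have "p dvd (x - y) * (x + y)"
      using that(3) by (simp add: power2_eq_square algebra_simps)
    then consider "p dvd x - y" | "p dvd x + y"
      using prime_dvd_mult_iff[OF \<open>prime p\<close>] by blast
    then show "x = y"
    proof cases
      case 1
      then show ?thesis
        using that p h zdvd_imp_le[of p "x - y"] zdvd_imp_le[of p "y - x"]
          dvd_diff_commute[of p x y] by (cases x y rule: linorder_cases) auto
    next
      case 2
      then show ?thesis
        using that p h zdvd_imp_le[of p "x + y"] by (cases "0 < x + y") auto
    qed
  qed
  let ?f = "\<lambda>x. x\<^sup>2 mod p" and ?g = "\<lambda>x. (- 1 - x\<^sup>2) mod p"
  have "inj_on ?f {0..h}" "inj_on ?g {0..h}"
    by (auto intro!: inj_onI inj simp: mod_eq_dvd_iff dvd_diff_commute)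
  then have "card (?f ` {0..h}) = nat (h + 1)" "card (?g ` {0..h}) = nat (h + 1)"
    by (simp_all add: card_image)
  moreover have "card (?f ` {0..h} \<union> ?g ` {0..h}) \<le> card {0..<p}"
    using prime_gt_0_int[OF \<open>prime p\<close>] by (intro card_mono) auto
  ultimately have "?f ` {0..h} \<inter> ?g ` {0..h} \<noteq> {}"
    using p h card_Un_disjoint[of "?f ` {0..h}" "?g ` {0..h}"] by auto
  then obtain a b where "a \<in> {0..h}" "b \<in> {0..h}" "?f a = ?g b"
    by blast
  then show ?thesis
    using p by (intro that[of a b]) (auto simp: mod_eq_dvd_iff algebra_simps)
qed

text \<open>Since rational squares are allowed, \<open>four_squares\<close> is closed under division, so that a multiple
  \<open>m p\<close> with \<open>m < p\<close> settles the prime \<open>p\<close> by induction, without a descent on \<open>m\<close>.\<close>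
lemma four_squares_of_nat: "four_squares (of_nat n :: rat)"
proof (induction n rule: less_induct)
  case (less n)
  consider "n \<le> 1" | "n = 2" | (mult) a b where "n = a * b" "a < n" "b < n" | (prime) "prime n" "n > 2"
  proof (cases "prime n \<or> n \<le> 1")
    case False
    then obtain a where "a dvd n" "a \<noteq> 1" "a \<noteq> n"
      by (auto simp: prime_nat_iff)
    then obtain b where "n = a * b" by auto
    have "a < n"
      using \<open>a dvd n\<close> \<open>a \<noteq> n\<close> False dvd_imp_le[of a n] by linarith
    moreover have "b < n"
      using \<open>n = a * b\<close> \<open>a \<noteq> 1\<close> False by (cases "a = 0") auto
    ultimately show ?thesis using \<open>n = a * b\<close> that(3) by blast
  next
    case True
    then show ?thesis using that(1,2,4) by linarith
  qed
  then show ?case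
  proof cases
    case 1
    then show ?thesis
      using four_squares_square[of "of_nat n :: rat"] by (cases n) auto
  next
    case 2
    then show ?thesis
      unfolding four_squares_def
      by - (rule exI[of _ 1], rule exI[of _ 1], rule exI[of _ 0], rule exI[of _ 0], simp)
  next
    case mult
    then show ?thesis
      using four_squares_mult[OF less less] by simp
  next
    case prime
    then have "prime (int n)" "odd (int n)"
      by (auto simp: prime_odd_nat)
    then obtain a b where ab: "0 \<le> a" "2 * a < int n" "0 \<le> b" "2 * b < int n"
        "int n dvd a\<^sup>2 + b\<^sup>2 + 1"
      by (rule odd_prime_dvd_two_squares_plus_one)
    then obtain m where m: "a\<^sup>2 + b\<^sup>2 + 1 = int n * m" by auto
    \<comment> \<open>The size bounds give \<open>4 * n * m < 4 * n * n\<close>, so the induction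
      hypothesis applies to the cofactor \<open>m\<close>, and \<open>n\<close> is then the quotient
      of \<open>n * m\<close> by \<open>m\<close>.\<close>
    have "(2 * a)\<^sup>2 \<le> (int n - 1)\<^sup>2" "(2 * b)\<^sup>2 \<le> (int n - 1)\<^sup>2"
      by (rule power_mono; use ab in linarith)+
    then have "4 * (int n * m) \<le> 2 * (int n - 1)\<^sup>2 + 4"
      unfolding m[symmetric] by (simp add: power_mult_distrib)
    also have "\<dots> < 4 * (int n * int n)"
    proof -
      have "2 * (int n - 1)\<^sup>2 + 4 = 2 * (int n * int n) - 4 * int n + 6"
        by (simp add: power2_eq_square algebra_simps)
      moreover have "0 \<le> int n * int n"
        by simp
      ultimately show ?thesis
        using \<open>n > 2\<close> by linarith
    qed
    finally have "m < int n"
      using prime by simp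
    have "0 < int n * m"
      unfolding m[symmetric] by (simp add: add_nonneg_pos)
    then have "m > 0"
      using prime by (simp add: zero_less_mult_iff)
    have "four_squares (of_nat (nat m) :: rat)"
      using \<open>m < int n\<close> \<open>m > 0\<close> prime by (intro less) simp
    moreover have "four_squares (of_int (int n * m) :: rat)"
      unfolding four_squares_def m[symmetric]
      by (rule exI[of _ "of_int a"], rule exI[of _ "of_int b"], rule exI[of _ 1], rule exI[of _ 0]) simp
    ultimately have "four_squares (of_int (int n * m) / of_nat (nat m) :: rat)"
      using four_squares_divide by blast
    also have "of_int (int n * m) / of_nat (nat m) = (of_nat n :: rat)"
      using \<open>m > 0\<close> by simp
    finally show ?thesis .
  qed
qed

lemma four_squares_rat:
  fixes q :: rat
  assumes "0 \<le> q"
  shows "four_squares q"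
proof -
  obtain a b where q: "q = of_int a / of_int b" "b > 0"
    by (cases q) (simp add: Fract_of_int_quotient)
  then have "a \<ge> 0"
    using assms by (simp add: zero_le_divide_iff)
  then have "q = of_nat (nat a) / of_nat (nat b)"
    using q by simp
  then show ?thesis
    by (simp add: four_squares_divide four_squares_of_nat)
qed

section \<open>Positive semidefinite quadratic forms\<close>

text \<open>Isolates the last variable, so that the form becomes a quadratic polynomial in
  \<open>x n\<close>, ready for completing the square.\<close>

lemma quadratic_form_Suc:
  fixes B :: "nat \<Rightarrow> nat \<Rightarrow> 'a::comm_ring_1"
  assumes "\<And>i. i < n \<Longrightarrow> B n i = B i n"
  shows "(\<Sum>i<Suc n. \<Sum>j<Suc n. B i j * x i * x j) =
    (\<Sum>i<n. \<Sum>j<n. B i j * x i * x j) + 2 * x n * (\<Sum>i<n. B i n * x i) + B n n * (x n)\<^sup>2"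
proof -
  have "(\<Sum>j<n. B n j * x n * x j) = x n * (\<Sum>i<n. B i n * x i)"
    unfolding sum_distrib_left using assms by (intro sum.cong) auto
  moreover have "(\<Sum>i<n. B i n * x i * x n) = x n * (\<Sum>i<n. B i n * x i)"
    unfolding sum_distrib_left by (intro sum.cong) auto
  ultimately show ?thesis
    by (simp add: sum.distrib power2_eq_square algebra_simps)
qed

text \<open>Lagrange reduction: completing the square in the last variable leaves a semidefinite
  form in the others. Keeping the weights \<open>a r\<close> outside the squares avoids square
  roots, so the argument runs over the rationals.\<close>

lemma psd_diagonalization:
  fixes B :: "nat \<Rightarrow> nat \<Rightarrow> 'a::linordered_field"
  assumes "\<And>i j. i < n \<Longrightarrow> j < n \<Longrightarrow> B i j = B j i"
    and "\<And>x. 0 \<le> (\<Sum>i<n. \<Sum>j<n. B i j * x i * x j)"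
  shows "\<exists>a c. (\<forall>r<n. 0 \<le> a r) \<and> (\<forall>i<n. \<forall>j<n. B i j = (\<Sum>r<n. a r * c r i * c r j))"
  using assms
proof (induction n arbitrary: B)
  case 0
  then show ?case by simp
next
  case (Suc n)
  have sym: "B i j = B j i" if "i < Suc n" "j < Suc n" for i j
    using Suc.prems(1) that .
  let ?d = "B n n"
  have psd: "0 \<le> (\<Sum>i<n. \<Sum>j<n. B i j * x i * x j) + 2 * t * (\<Sum>i<n. B i n * x i) + ?d * t\<^sup>2" for x t
  proof -
    have "0 \<le> (\<Sum>i<Suc n. \<Sum>j<Suc n. B i j * (x(n := t)) i * (x(n := t)) j)"
      by (rule Suc.prems(2))
    also have "\<dots> = (\<Sum>i<n. \<Sum>j<n. B i j * x i * x j) + 2 * t * (\<Sum>i<n. B i n * x i) + ?d * t\<^sup>2"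
      by (subst quadratic_form_Suc) (auto simp: sym intro!: sum.cong)
    finally show ?thesis .
  qed
  have d: "0 \<le> ?d"
    using psd[of "\<lambda>_. 0" 1] by simp
  have zero: "B i n = 0" if "?d = 0" "i < n" for i
  proof (rule ccontr)
    assume "B i n \<noteq> 0"
    let ?x = "\<lambda>j. if j = i then 1 else 0 :: 'a"
    have "(\<Sum>k<n. \<Sum>j<n. B k j * ?x k * ?x j) =
        (\<Sum>k<n. if k = i then \<Sum>j<n. if j = i then B i i else 0 else 0)"
      by (auto intro!: sum.cong simp: if_distrib[of "\<lambda>t. _ * t"] cong: if_cong)
    moreover have "(\<Sum>k<n. B k n * ?x k) = (\<Sum>k<n. if k = i then B i n else 0)"
      by (intro sum.cong) auto
    ultimately have "(\<Sum>k<n. \<Sum>j<n. B k j * ?x k * ?x j) = B i i" "(\<Sum>k<n. B k n * ?x k) = B i n"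
      using \<open>i < n\<close> by simp_all
    \<comment> \<open>At the \<open>i\<close>-th unit vector and this \<open>t\<close>, the form
      \<open>B i i + 2 * t * B i n\<close> takes the value -1.\<close>
    then show False
      using psd[of ?x "- (B i i + 1) / (2 * B i n)"] \<open>?d = 0\<close> \<open>B i n \<noteq> 0\<close>
      by (simp add: field_simps)
  qed
  \<comment> \<open>If \<open>?d = 0\<close>, then all divisions by \<open>?d\<close> give \<open>0\<close>, which is the right value because of \<open>zero\<close>.\<close>
  define B' where "B' i j = B i j - B i n * B j n / ?d" for i j
  have "0 \<le> (\<Sum>i<n. \<Sum>j<n. B' i j * x i * x j)" for x
  proof -
    let ?S = "\<Sum>i<n. B i n * x i"
    have "(\<Sum>i<n. \<Sum>j<n. B' i j * x i * x j) =
        (\<Sum>i<n. \<Sum>j<n. B i j * x i * x j) - (\<Sum>i<n. \<Sum>j<n. (B i n * x i) * (B j n * x j) / ?d)"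
      unfolding B'_def sum_subtractf[symmetric] by (intro sum.cong) (auto simp: algebra_simps)
    also have "(\<Sum>i<n. \<Sum>j<n. (B i n * x i) * (B j n * x j) / ?d) = ?S\<^sup>2 / ?d"
      unfolding power2_eq_square sum_product sum_divide_distrib ..
    \<comment> \<open>The value \<open>- ?S / ?d\<close> minimizes the form in the last variable
      when \<open>?d > 0\<close>, and the minimum is the reduced form \<open>B'\<close> at
      \<open>x\<close>.\<close>
    also have "(\<Sum>i<n. \<Sum>j<n. B i j * x i * x j) - ?S\<^sup>2 / ?d
        = (\<Sum>i<n. \<Sum>j<n. B i j * x i * x j) + 2 * (- ?S / ?d) * ?S + ?d * (- ?S / ?d)\<^sup>2"
      by (cases "?d = 0") (simp_all add: power2_eq_square)
    also have "\<dots> \<ge> 0"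
      by (rule psd)
    finally show ?thesis .
  qed
  moreover have "B' i j = B' j i" if "i < n" "j < n" for i j
    using that unfolding B'_def by (simp add: sym mult.commute)
  ultimately obtain a c where a: "\<forall>r<n. 0 \<le> a r"
    and c: "\<forall>i<n. \<forall>j<n. B' i j = (\<Sum>r<n. a r * c r i * c r j)"
    using Suc.IH[of B'] by blast
  \<comment> \<open>The completed square adds the weight \<open>?d\<close> with linear form
    \<open>B i n / ?d\<close>. The earlier linear forms are extended by 0 to the index
    \<open>n\<close>.\<close>
  define a' where "a' r = (if r < n then a r else ?d)" for r
  define c' where "c' r i = (if r < n then if i < n then c r i else 0 else B i n / ?d)" for r i
  have "B i j = (\<Sum>r<Suc n. a' r * c' r i * c' r j)" if "i < Suc n" "j < Suc n" for i j
  proof (cases "i < n \<and> j < n")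
    case True
    then have "B' i j = (\<Sum>r<n. a' r * c' r i * c' r j)"
      using c by (simp add: a'_def c'_def)
    then show ?thesis
      by (cases "?d = 0") (simp_all add: B'_def a'_def c'_def zero)
  next
    case False
    then have "(\<Sum>r<n. a' r * c' r i * c' r j) = 0"
      by (intro sum.neutral) (auto simp: c'_def)
    moreover have "?d * (B i n / ?d) * (B j n / ?d) = B i j"
    proof -
      consider "i = n" | "j = n" using False \<open>i < Suc n\<close> \<open>j < Suc n\<close> by linarith
      then show ?thesis
      proof cases
        case 1
        then show ?thesis
          using zero[of j] sym[of j n] that by (cases "?d = 0"; cases "j = n") auto
      next
        case 2
        then show ?thesis
          using zero[of i] that by (cases "?d = 0"; cases "i = n") auto
      qed
    qed
    ultimately show ?thesis
      by (simp add: a'_def c'_def)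
  qed
  moreover have "\<forall>r<Suc n. 0 \<le> a' r"
    using a d by (simp add: a'_def)
  ultimately show ?case by blast
qed

section \<open>Traces of squares of complex matrices\<close>

lemma sum_diag_mult_commute:
  fixes A B :: "'a::comm_semiring_0 mat"
  assumes "A \<in> carrier_mat n n" "B \<in> carrier_mat n n"
  shows "(\<Sum>i<n. (A * B) $$ (i, i)) = (\<Sum>i<n. (B * A) $$ (i, i))"
proof -
  have "(\<Sum>i<n. (A * B) $$ (i, i)) = (\<Sum>i<n. \<Sum>j<n. A $$ (i, j) * B $$ (j, i))"
    using assms by (auto simp: scalar_prod_def atLeast0LessThan intro!: sum.cong)
  also have "\<dots> = (\<Sum>j<n. \<Sum>i<n. B $$ (j, i) * A $$ (i, j))"
    by (subst sum.swap) (simp add: mult.commute)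
  also have "\<dots> = (\<Sum>i<n. (B * A) $$ (i, i))"
    using assms by (auto simp: scalar_prod_def atLeast0LessThan intro!: sum.cong)
  finally show ?thesis .
qed

text \<open>By Schur decomposition \<open>A\<close> is similar to an upper triangular
  \<open>B\<close>, so the trace of \<open>A * A\<close> is the sum of the squares of the diagonal
  entries of \<open>B\<close>. These are eigenvalues of \<open>A\<close>, hence real.\<close>

lemma mat_trace_square_nonneg:
  fixes A :: "complex mat"
  assumes A: "A \<in> carrier_mat n n" and real: "\<And>e. eigenvalue A e \<Longrightarrow> e \<in> \<real>"
  shows "0 \<le> Re (\<Sum>i<n. (A * A) $$ (i, i))"
proof -
  obtain es where es: "char_poly A = (\<Prod>e\<leftarrow>es. [:- e, 1:])"
    using char_poly_factorized[OF A] by blast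
  obtain B P Q where "schur_decomposition A es = (B, P, Q)"
    by (cases "schur_decomposition A es")
  from schur_decomposition[OF A es this]
  have wit: "similar_mat_wit A B P Q" and ut: "upper_triangular B" and diag: "diag_mat B = es"
    by auto
  have carrier: "B \<in> carrier_mat n n" "P \<in> carrier_mat n n" "Q \<in> carrier_mat n n"
    and QP: "Q * P = 1\<^sub>m n"
    using similar_mat_witD2[OF A wit] by auto
  have "A * A = P * (B * B) * Q"
    using similar_mat_wit_pow[OF wit, of 2] A carrier
    unfolding similar_mat_wit_def by (auto simp: numeral_2_eq_2 Let_def)
  then have "(\<Sum>i<n. (A * A) $$ (i, i)) = (\<Sum>i<n. (Q * (P * (B * B))) $$ (i, i))"
    by (simp only:) (rule sum_diag_mult_commute; use carrier in auto)
  also have "Q * (P * (B * B)) = B * B"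
    using carrier QP by (simp flip: assoc_mult_mat[of Q n n P n "B * B" n])
  also have "(\<Sum>i<n. (B * B) $$ (i, i)) = (\<Sum>i<n. (B $$ (i, i))\<^sup>2)"
  proof (intro sum.cong refl)
    fix i assume "i \<in> {..<n}"
    then have "(B * B) $$ (i, i) = (\<Sum>j<n. B $$ (i, j) * B $$ (j, i))"
      using carrier by (auto simp: scalar_prod_def atLeast0LessThan intro!: sum.cong)
    \<comment> \<open>For \<open>j \<noteq> i\<close>, one of the entries at \<open>(i, j)\<close>
      and \<open>(j, i)\<close> lies below the diagonal and vanishes.\<close>
    also have "\<dots> = (\<Sum>j<n. if j = i then (B $$ (i, i))\<^sup>2 else 0)"
    proof (intro sum.cong refl)
      fix j assume "j \<in> {..<n}"
      then show "B $$ (i, j) * B $$ (j, i) = (if j = i then (B $$ (i, i))\<^sup>2 else 0)"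
        using upper_triangularD[OF ut, of i j] upper_triangularD[OF ut, of j i] carrier \<open>i \<in> {..<n}\<close>
        by (cases i j rule: linorder_cases) (auto simp: power2_eq_square)
    qed
    finally show "(B * B) $$ (i, i) = (B $$ (i, i))\<^sup>2"
      using \<open>i \<in> {..<n}\<close> by simp
  qed
  also have "0 \<le> Re \<dots>"
  proof -
    have "0 \<le> Re ((B $$ (i, i))\<^sup>2)" if "i < n" for i
    proof -
      have "B $$ (i, i) \<in> set es"
        using that carrier unfolding diag[symmetric] diag_mat_def by auto
      then have "poly (char_poly A) (B $$ (i, i)) = 0"
        unfolding es by (auto simp: poly_prod_list prod_list_zero_iff)
      then have "B $$ (i, i) \<in> \<real>"
        using real by (simp add: eigenvalue_root_char_poly[OF A])
      then show ?thesis
        by (simp add: complex_is_Real_iff)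
    qed
    then show ?thesis
      unfolding Re_sum by (intro sum_nonneg) simp_all
  qed
  finally show ?thesis .
qed

section \<open>Complex embeddings from eigenvalues\<close>

lemma subfield_closed:
  assumes "is_subfield K" "x \<in> K" "y \<in> K"
  shows "x + y \<in> K" "x * y \<in> K"
  using assms unfolding is_subfield_def by auto

lemma subfield_power:
  assumes "is_subfield K" "x \<in> K"
  shows "x ^ i \<in> K"
  using assms by (induction i) (auto simp: is_subfield_def)

text \<open>With \<open>N\<close> the size of a finite spanning set, the \<open>N + 1\<close> powers
  of \<open>s\<close> up to \<open>s ^ N\<close> cannot be independent.\<close>

lemma number_field_rational_relation:
  assumes "is_number_field K" "s \<in> K"
  obtains u :: "nat \<Rightarrow> rat" and i N where
    "i \<le> N" "u i \<noteq> 0" "(\<Sum>i\<le>N. of_rat (u i) * s ^ i) = 0"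
proof -
  obtain B where B: "finite B" "rat_vec.span B = K"
    using assms(1) unfolding is_number_field_def by blast
  have K: "is_subfield K"
    using assms(1) unfolding is_number_field_def by blast
  define N where "N = card B"
  show thesis
  \<comment> \<open>Dependence is a property of the set of powers and so misses repetitions. If two
    powers coincide, their difference is the relation.\<close>
  proof (cases "inj_on (\<lambda>i. s ^ i) {..N}")
    case True
    let ?S = "(\<lambda>i. s ^ i) ` {..N}"
    have "?S \<subseteq> rat_vec.span B"
      using B subfield_power[OF K assms(2)] by auto
    moreover have "card ?S > card B"
      using True by (simp add: card_image N_def)
    ultimately have "rat_vec.dependent ?S"
      using rat_vec.independent_span_bound[OF B(1), of ?S] by fastforce
    then obtain u v where "v \<in> ?S" "u v \<noteq> 0" "(\<Sum>v\<in>?S. of_rat (u v) * v) = 0"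
      by (auto simp: rat_vec.dependent_finite)
    then show thesis
      using True that[of _ N "\<lambda>i. u (s ^ i)"] by (auto simp: sum.reindex)
  next
    case False
    then obtain i j where ij: "i \<le> N" "j \<le> N" "i \<noteq> j" "s ^ i = s ^ j"
      by (auto simp: inj_on_def)
    let ?u = "\<lambda>l. of_bool (l = i) - of_bool (l = j) :: rat"
    have "(\<Sum>l\<le>N. of_rat (?u l) * s ^ l) =
        (\<Sum>l\<le>N. if l = i then s ^ i else 0) - (\<Sum>l\<le>N. if l = j then s ^ j else 0)"
      unfolding sum_subtractf[symmetric] by (intro sum.cong) (auto simp: of_rat_diff)
    also have "\<dots> = 0"
      using ij by simp
    finally show thesis
      using ij that[of i N ?u] by simp
  qed
qed

text \<open>Linearity is asked on the whole ambient field, so that sums can be moved through \<phi>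
  without membership conditions.\<close>

definition rat_linear :: "('a::field_char_0 \<Rightarrow> complex) \<Rightarrow> bool" where
  "rat_linear \<phi> \<longleftrightarrow>
     (\<forall>x y. \<phi> (x + y) = \<phi> x + \<phi> y) \<and> (\<forall>q x. \<phi> (of_rat q * x) = of_rat q * \<phi> x)"

lemma rat_linear_sum:
  assumes "rat_linear \<phi>"
  shows "\<phi> (\<Sum>i\<in>I. of_rat (q i) * x i) = (\<Sum>i\<in>I. of_rat (q i) * \<phi> (x i))"
proof -
  have "\<phi> 0 = 0"
    using assms unfolding rat_linear_def by (metis add_cancel_right_right)
  then show ?thesis
    using assms unfolding rat_linear_def by (induction I rule: infinite_finite_induct) auto
qed

text \<open>This stands for the functional \<open>z \<mapsto> \<phi> (g(s) * z)\<close>, extended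
  linearly in \<open>g\<close> to complex coefficients, since \<open>g(s)\<close> itself need not
  make sense in \<open>'a\<close>.\<close>

definition poly_act :: "complex poly \<Rightarrow> 'a::field_char_0 \<Rightarrow> ('a \<Rightarrow> complex) \<Rightarrow> 'a \<Rightarrow> complex" where
  "poly_act g s \<phi> z = (\<Sum>i\<le>degree g. coeff g i * \<phi> (s ^ i * z))"

lemma poly_act_bound:
  assumes "degree g \<le> N"
  shows "poly_act g s \<phi> z = (\<Sum>i\<le>N. coeff g i * \<phi> (s ^ i * z))"
  unfolding poly_act_def using assms
  by (intro sum.mono_neutral_left) (auto simp: coeff_eq_0)

text \<open>The variable of the polynomial acts as multiplication of the argument by
  \<open>s\<close>, which shifts coefficients. Where the product annihilates \<phi>,
  \<open>h\<close> therefore gives an eigenvector equation with eigenvalue \<mu>.\<close>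

lemma poly_act_linear_factor:
  "poly_act ([:- \<mu>, 1:] * h) s \<phi> z = poly_act h s \<phi> (s * z) - \<mu> * poly_act h s \<phi> z"
proof -
  let ?N = "degree h"
  have coeff: "coeff ([:- \<mu>, 1:] * h) i = coeff (pCons 0 h) i - \<mu> * coeff h i" for i
    by simp
  have "degree ([:- \<mu>, 1:] * h) \<le> Suc ?N"
    by (rule order.trans[OF degree_mult_le]) simp
  then have "poly_act ([:- \<mu>, 1:] * h) s \<phi> z =
      (\<Sum>i\<le>Suc ?N. coeff (pCons 0 h) i * \<phi> (s ^ i * z)) - \<mu> * (\<Sum>i\<le>Suc ?N. coeff h i * \<phi> (s ^ i * z))"
    by (simp only: poly_act_bound coeff left_diff_distrib sum_subtractf sum_distrib_left mult.assoc)
  also have "(\<Sum>i\<le>Suc ?N. coeff h i * \<phi> (s ^ i * z)) = poly_act h s \<phi> z"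
    by (rule poly_act_bound[symmetric]) simp
  also have "(\<Sum>i\<le>Suc ?N. coeff (pCons 0 h) i * \<phi> (s ^ i * z)) = poly_act h s \<phi> (s * z)"
    unfolding sum.atMost_Suc_shift poly_act_def by (simp add: mult_ac)
  finally show ?thesis .
qed

lemma rat_linear_poly_act:
  assumes "rat_linear \<phi>"
  shows "rat_linear (poly_act g s \<phi>)"
proof -
  have "\<phi> (s ^ i * (x + y)) = \<phi> (s ^ i * x) + \<phi> (s ^ i * y)"
       "\<phi> (s ^ i * (of_rat q * x)) = of_rat q * \<phi> (s ^ i * x)" for i q x y
    using assms unfolding rat_linear_def by (metis distrib_left, metis mult.left_commute)
  then show ?thesis
    unfolding rat_linear_def poly_act_def
    by (simp add: distrib_left sum.distrib sum_distrib_left mult.left_commute)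
qed

text \<open>The eigenfunctional is \<open>h\<close> applied to \<open>\<phi>\<close>, where \<open>(X - \<mu>) h\<close> is a polynomial of least
  degree in the operator ``multiplication by \<open>s\<close>'' that annihilates \<open>\<phi>\<close> on \<open>K\<close>.\<close>
lemma poly_act_eigenfunctional:
  assumes K: "is_number_field K" and s: "s \<in> K" and \<phi>: "rat_linear \<phi>" and "\<exists>z\<in>K. \<phi> z \<noteq> 0"
  obtains h \<mu> where "\<exists>z\<in>K. poly_act h s \<phi> z \<noteq> 0"
    "\<And>z. z \<in> K \<Longrightarrow> poly_act h s \<phi> (s * z) = \<mu> * poly_act h s \<phi> z"
proof -
  let ?ann = "\<lambda>g. g \<noteq> 0 \<and> (\<forall>z\<in>K. poly_act g s \<phi> z = 0)"
  obtain u :: "nat \<Rightarrow> rat" and j N where u: "j \<le> N" "u j \<noteq> 0" "(\<Sum>i\<le>N. of_rat (u i) * s ^ i) = 0"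
    using number_field_rational_relation[OF K s] .
  \<comment> \<open>The rational relation for \<open>s\<close>, read as a complex polynomial. Its
    coefficients are rational and move inside \<phi>, which leaves \<phi> at 0.\<close>
  define g0 :: "complex poly" where "g0 = (\<Sum>i\<le>N. monom (of_rat (u i)) i)"
  have g0: "coeff g0 i = (if i \<le> N then of_rat (u i) else 0)" for i
    unfolding g0_def by (simp add: coeff_sum coeff_monom)
  have "?ann g0"
  proof
    show "g0 \<noteq> 0"
      using u g0[of j] by auto
    have "degree g0 \<le> N"
      by (rule degree_le) (simp add: g0)
    then have "poly_act g0 s \<phi> z = \<phi> (\<Sum>i\<le>N. of_rat (u i) * (s ^ i * z))" for z
      by (simp add: poly_act_bound g0 rat_linear_sum[OF \<phi>])
    moreover have "(\<Sum>i\<le>N. of_rat (u i) * (s ^ i * z)) = 0" for z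
      using u(3) by (simp flip: mult.assoc sum_distrib_right)
    moreover have "\<phi> 0 = 0"
      using \<phi> unfolding rat_linear_def by (metis add_cancel_right_right)
    ultimately show "\<forall>z\<in>K. poly_act g0 s \<phi> z = 0" by simp
  qed
  then obtain g where g: "?ann g" and min: "\<And>h. degree h < degree g \<Longrightarrow> \<not> ?ann h"
    using exists_least_iff[of "\<lambda>d. \<exists>g. degree g = d \<and> ?ann g"] by metis
  \<comment> \<open>A nonzero constant annihilating \<phi> would force \<phi> to vanish on
    \<open>K\<close>. So \<open>g\<close> is nonconstant and has a complex root.\<close>
  have "degree g \<noteq> 0"
  proof
    assume "degree g = 0"
    then have "poly_act g s \<phi> z = coeff g 0 * \<phi> z" for z
      by (simp add: poly_act_def)
    then show False
      using g assms(4) \<open>degree g = 0\<close> by (metis leading_coeff_0_iff mult_eq_0_iff)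
  qed
  then obtain \<mu> where "poly g \<mu> = 0"
    using fundamental_theorem_of_algebra[of g] by (auto simp: constant_degree)
  then obtain h where h: "g = [:- \<mu>, 1:] * h"
    by (auto simp: poly_eq_0_iff_dvd)
  then have "h \<noteq> 0" using g by auto
  then have "degree h < degree g"
    unfolding h by (subst degree_mult_eq) auto
  then have "\<exists>z\<in>K. poly_act h s \<phi> z \<noteq> 0"
    using min \<open>h \<noteq> 0\<close> by blast
  moreover have "poly_act h s \<phi> (s * z) = \<mu> * poly_act h s \<phi> z" if "z \<in> K" for z
    using g that poly_act_linear_factor[of \<mu> h s \<phi> z] unfolding h by simp
  ultimately show thesis by (rule that)
qed

text \<open>Multiplications by \<open>s\<close> and by \<open>t\<close> commute, so an action by
  powers of \<open>s\<close> respects eigenvalue equations for \<open>t\<close>.\<close>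

lemma poly_act_preserves_eigenfunctional:
  assumes K: "is_subfield K" and "s \<in> K" and eigen: "\<And>z. z \<in> K \<Longrightarrow> \<phi> (t * z) = \<mu> * \<phi> z"
    and "z \<in> K"
  shows "poly_act g s \<phi> (t * z) = \<mu> * poly_act g s \<phi> z"
proof -
  have "\<phi> (s ^ i * (t * z)) = \<mu> * \<phi> (s ^ i * z)" for i
    using eigen[of "s ^ i * z"] assms by (simp add: subfield_closed subfield_power mult.left_commute)
  then show ?thesis
    unfolding poly_act_def by (simp add: sum_distrib_left mult.left_commute)
qed

text \<open>Commuting operators have a common eigenvector: each new \<open>s\<close> is treated by
  some \<open>poly_act h s\<close>, which keeps the eigenvalue equations already obtained.\<close>

lemma common_eigenfunctional:
  assumes K: "is_number_field K" and \<phi>: "rat_linear \<phi>" "\<exists>z\<in>K. \<phi> z \<noteq> 0"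
    and x: "\<And>z. z \<in> K \<Longrightarrow> \<phi> (x * z) = e * \<phi> z"
    and S: "finite S" "S \<subseteq> K"
  shows "\<exists>\<psi>. rat_linear \<psi> \<and> (\<exists>z\<in>K. \<psi> z \<noteq> 0) \<and> (\<forall>z\<in>K. \<psi> (x * z) = e * \<psi> z) \<and>
    (\<forall>s\<in>S. \<exists>\<mu>. \<forall>z\<in>K. \<psi> (s * z) = \<mu> * \<psi> z)"
  using S
proof (induction S rule: finite_induct)
  case empty
  then show ?case using \<phi> x by auto
next
  case (insert s S)
  have sub: "is_subfield K"
    using K unfolding is_number_field_def by blast
  have s: "s \<in> K" using insert.prems by simp
  obtain \<psi> where \<psi>: "rat_linear \<psi>" "\<exists>z\<in>K. \<psi> z \<noteq> 0" "\<And>z. z \<in> K \<Longrightarrow> \<psi> (x * z) = e * \<psi> z"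
    and eigen: "\<forall>t\<in>S. \<exists>\<mu>. \<forall>z\<in>K. \<psi> (t * z) = \<mu> * \<psi> z"
    using insert by blast
  obtain h \<mu> where h: "\<exists>z\<in>K. poly_act h s \<psi> z \<noteq> 0"
    "\<And>z. z \<in> K \<Longrightarrow> poly_act h s \<psi> (s * z) = \<mu> * poly_act h s \<psi> z"
    using poly_act_eigenfunctional[OF K s \<psi>(1,2)] by blast
  have "\<exists>\<mu>. \<forall>z\<in>K. poly_act h s \<psi> (t * z) = \<mu> * poly_act h s \<psi> z" if "t \<in> S" for t
    using eigen that poly_act_preserves_eigenfunctional[OF sub s, of \<psi> t _ _ h] by metis
  moreover have "poly_act h s \<psi> (x * z) = e * poly_act h s \<psi> z" if "z \<in> K" for z
    using poly_act_preserves_eigenfunctional[where \<phi> = \<psi> and t = x and \<mu> = e, OF sub s \<psi>(3) that] .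
  ultimately show ?case
    using h rat_linear_poly_act[OF \<psi>(1)]
    by (intro exI[of _ "poly_act h s \<psi>"]) blast
qed

text \<open>A common eigenfunctional \<psi> for a finite spanning set is one for all of
  \<open>K\<close>. Its eigenvalues \<sigma> satisfy \<open>\<psi> y = \<sigma> y * \<psi> 1\<close>
  with \<open>\<psi> 1 \<noteq> 0\<close>, and cancelling \<open>\<psi> 1\<close> makes \<sigma>
  additive and multiplicative.\<close>

lemma embedding_of_eigenfunctional:
  assumes K: "is_number_field K" and \<phi>: "rat_linear \<phi>" "\<exists>z\<in>K. \<phi> z \<noteq> 0"
    and "x \<in> K" and x: "\<And>z. z \<in> K \<Longrightarrow> \<phi> (x * z) = e * \<phi> z"
  obtains \<sigma> where "complex_embedding K \<sigma>" "\<sigma> x = e"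
proof -
  obtain B where B: "finite B" "rat_vec.span B = K" and sub: "is_subfield K"
    using K unfolding is_number_field_def by blast
  then have "B \<subseteq> K"
    using rat_vec.span_superset by blast
  obtain \<psi> where \<psi>: "rat_linear \<psi>" "\<exists>z\<in>K. \<psi> z \<noteq> 0" "\<And>z. z \<in> K \<Longrightarrow> \<psi> (x * z) = e * \<psi> z"
    and eigen: "\<forall>t\<in>B. \<exists>\<mu>. \<forall>z\<in>K. \<psi> (t * z) = \<mu> * \<psi> z"
    using common_eigenfunctional[OF K \<phi> x B(1) \<open>B \<subseteq> K\<close>] by blast
  have add: "\<psi> (y + z) = \<psi> y + \<psi> z" and scale: "\<psi> (of_rat q * z) = of_rat q * \<psi> z" for q y z
    using \<psi>(1) unfolding rat_linear_def by auto
  \<comment> \<open>The elements acting on \<psi> by a scalar form a rational subspace, so it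
    suffices that it contains \<open>B\<close>.\<close>
  have "rat_vec.span B \<subseteq> {y. \<exists>\<mu>. \<forall>z\<in>K. \<psi> (y * z) = \<mu> * \<psi> z}"
  proof (rule rat_vec.span_minimal)
    show "rat_vec.subspace {y. \<exists>\<mu>. \<forall>z\<in>K. \<psi> (y * z) = \<mu> * \<psi> z}"
      unfolding rat_vec.subspace_def
    proof (safe)
      show "\<exists>\<mu>. \<forall>z\<in>K. \<psi> (0 * z) = \<mu> * \<psi> z"
        using scale[of 0] by (intro exI[of _ 0]) simp
    next
      fix y y' \<mu> \<mu>'
      assume "\<forall>z\<in>K. \<psi> (y * z) = \<mu> * \<psi> z" "\<forall>z\<in>K. \<psi> (y' * z) = \<mu>' * \<psi> z"
      then show "\<exists>\<mu>. \<forall>z\<in>K. \<psi> ((y + y') * z) = \<mu> * \<psi> z"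
        by (intro exI[of _ "\<mu> + \<mu>'"]) (simp add: distrib_right add)
    next
      fix q y \<mu>
      assume "\<forall>z\<in>K. \<psi> (y * z) = \<mu> * \<psi> z"
      then show "\<exists>\<mu>. \<forall>z\<in>K. \<psi> (of_rat q * y * z) = \<mu> * \<psi> z"
        by (intro exI[of _ "of_rat q * \<mu>"]) (simp add: mult.assoc scale)
    qed
  qed (use eigen in auto)
  then have "\<forall>y\<in>K. \<exists>\<mu>. \<forall>z\<in>K. \<psi> (y * z) = \<mu> * \<psi> z"
    using B by blast
  then obtain \<sigma> where \<sigma>: "\<And>y z. y \<in> K \<Longrightarrow> z \<in> K \<Longrightarrow> \<psi> (y * z) = \<sigma> y * \<psi> z"
    by metis
  have "1 \<in> K"
    using sub by (simp add: is_subfield_def)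
  then have \<psi>_eq: "\<psi> y = \<sigma> y * \<psi> 1" if "y \<in> K" for y
    using \<sigma>[OF that, of 1] by simp
  then have "\<psi> 1 \<noteq> 0"
    using \<psi>(2) by fastforce
  have "complex_embedding K \<sigma>"
    unfolding complex_embedding_def
  proof (intro conjI ballI)
    show "\<sigma> 1 = 1"
      using \<psi>_eq[OF \<open>1 \<in> K\<close>] \<open>\<psi> 1 \<noteq> 0\<close> by simp
    fix y z assume yz: "y \<in> K" "z \<in> K"
    have "\<sigma> (y + z) * \<psi> 1 = (\<sigma> y + \<sigma> z) * \<psi> 1"
      using yz by (simp add: \<psi>_eq[symmetric] subfield_closed[OF sub] add distrib_right)
    then show "\<sigma> (y + z) = \<sigma> y + \<sigma> z"
      using \<open>\<psi> 1 \<noteq> 0\<close> by simp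
    have "\<sigma> (y * z) * \<psi> 1 = (\<sigma> y * \<sigma> z) * \<psi> 1"
      using yz by (simp add: \<psi>_eq[symmetric] subfield_closed[OF sub] \<sigma> mult.assoc)
    then show "\<sigma> (y * z) = \<sigma> y * \<sigma> z"
      using \<open>\<psi> 1 \<noteq> 0\<close> by simp
  qed
  moreover have "\<sigma> x = e"
    using \<psi>(3)[OF \<open>1 \<in> K\<close>] \<psi>_eq[OF \<open>x \<in> K\<close>] \<open>\<psi> 1 \<noteq> 0\<close> by simp
  ultimately show thesis by (rule that)
qed

section \<open>The trace form\<close>

text \<open>A basis \<open>b\<close> of \<open>K\<close> with its coordinate functions
  \<open>c\<close>. These are linear on the whole ambient field, while the expansion is asserted on
  \<open>K\<close> only.\<close>

locale number_field_basis =
  fixes K :: "'a::field_char_0 set" and k :: nat and b :: "nat \<Rightarrow> 'a" and c :: "nat \<Rightarrow> 'a \<Rightarrow> rat"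
  assumes number_field: "is_number_field K"
    and basis_in: "\<And>j. j < k \<Longrightarrow> b j \<in> K"
    and coord_add: "\<And>j x y. c j (x + y) = c j x + c j y"
    and coord_scale: "\<And>j q x. c j (of_rat q * x) = q * c j x"
    and coord_basis: "\<And>i j. i < k \<Longrightarrow> j < k \<Longrightarrow> c i (b j) = (if i = j then 1 else 0)"
    and expansion: "\<And>x. x \<in> K \<Longrightarrow> x = (\<Sum>j<k. of_rat (c j x) * b j)"
begin

lemma subfield: "is_subfield K"
  using number_field unfolding is_number_field_def by blast

lemma coord_sum: "c i (\<Sum>j\<in>J. of_rat (q j) * x j) = (\<Sum>j\<in>J. q j * c i (x j))"
proof -
  have "c i 0 = 0"
    using coord_add[of i 0 0] by simp
  then show ?thesis
    by (induction J rule: infinite_finite_induct) (auto simp: coord_add coord_scale)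
qed

definition trace :: "'a \<Rightarrow> rat" where
  "trace x = (\<Sum>i<k. c i (x * b i))"

lemma trace_add: "trace (x + y) = trace x + trace y"
  unfolding trace_def by (simp add: distrib_right coord_add sum.distrib)

lemma trace_scale: "trace (of_rat q * x) = q * trace x"
  unfolding trace_def by (simp only: mult.assoc coord_scale sum_distrib_left)

lemma trace_one: "trace 1 = of_nat k"
  unfolding trace_def by (simp add: coord_basis)

text \<open>Row \<open>i\<close> holds the coordinates of \<open>x * b i\<close>, the transpose of
  the usual convention. A column vector thus lists the values of a functional on the basis, and
  eigenvectors correspond to eigenfunctionals.\<close>

definition mult_mat :: "'a \<Rightarrow> complex mat" where
  "mult_mat x = mat k k (\<lambda>(i, j). of_rat (c j (x * b i)))"

lemma mult_mat_carrier: "mult_mat x \<in> carrier_mat k k"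
  unfolding mult_mat_def by simp

text \<open>Multiplication by \<open>x\<close> applied twice is given by the square of its matrix,
  here compared on the diagonal.\<close>

lemma of_rat_trace_square:
  assumes "x \<in> K"
  shows "of_rat (trace (x\<^sup>2)) = (\<Sum>i<k. (mult_mat x * mult_mat x) $$ (i, i))"
  unfolding trace_def of_rat_sum
proof (intro sum.cong refl)
  fix i assume i: "i \<in> {..<k}"
  have "x * b i = (\<Sum>j<k. of_rat (c j (x * b i)) * b j)"
    using i assms by (intro expansion subfield_closed[OF subfield] basis_in) auto
  then have "x\<^sup>2 * b i = x * (\<Sum>j<k. of_rat (c j (x * b i)) * b j)"
    by (simp add: power2_eq_square mult.assoc)
  also have "\<dots> = (\<Sum>j<k. of_rat (c j (x * b i)) * (x * b j))"
    unfolding sum_distrib_left by (intro sum.cong) (auto simp: mult_ac)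
  finally have "c i (x\<^sup>2 * b i) = (\<Sum>j<k. c j (x * b i) * c i (x * b j))"
    by (simp add: coord_sum)
  then show "of_rat (c i (x\<^sup>2 * b i)) = (mult_mat x * mult_mat x) $$ (i, i)"
    using i by (auto simp: mult_mat_def scalar_prod_def atLeast0LessThan of_rat_sum of_rat_mult
        intro!: sum.cong)
qed

text \<open>An eigenvector \<open>v\<close> defines the functional with value \<open>v $ j\<close>
  at \<open>b j\<close>. The matrix equation is its eigenvalue equation on the basis, which extends
  to \<open>K\<close> by linearity.\<close>

lemma embedding_of_eigenvalue:
  assumes "x \<in> K" "eigenvalue (mult_mat x) e"
  obtains \<sigma> where "complex_embedding K \<sigma>" "\<sigma> x = e"
proof -
  obtain v where v: "v \<in> carrier_vec k" "v \<noteq> 0\<^sub>v k" "mult_mat x *\<^sub>v v = e \<cdot>\<^sub>v v"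
    using assms(2) mult_mat_carrier[of x] unfolding eigenvalue_def eigenvector_def by auto
  define \<phi> where "\<phi> z = (\<Sum>j<k. of_rat (c j z) * v $ j)" for z
  have "\<phi> (y + z) = \<phi> y + \<phi> z" for y z
    unfolding \<phi>_def by (simp add: coord_add of_rat_add distrib_right sum.distrib)
  moreover have "\<phi> (of_rat q * z) = of_rat q * \<phi> z" for q z
    unfolding \<phi>_def sum_distrib_left by (simp only: coord_scale of_rat_mult mult.assoc)
  ultimately have lin: "rat_linear \<phi>"
    unfolding rat_linear_def by blast
  have \<phi>_basis: "\<phi> (b j) = v $ j" if "j < k" for j
  proof -
    have "\<phi> (b j) = (\<Sum>i<k. if i = j then v $ j else 0)"
      unfolding \<phi>_def using that by (intro sum.cong) (auto simp: coord_basis)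
    then show ?thesis using that by simp
  qed
  have \<phi>_mult_basis: "\<phi> (x * b i) = e * \<phi> (b i)" if "i < k" for i
  proof -
    have "\<phi> (x * b i) = (mult_mat x *\<^sub>v v) $ i"
      using that v(1) unfolding \<phi>_def
      by (auto simp: mult_mat_def scalar_prod_def atLeast0LessThan intro!: sum.cong)
    then show ?thesis
      using that v(1) by (simp add: v(3) \<phi>_basis)
  qed
  have "\<phi> (x * z) = e * \<phi> z" if "z \<in> K" for z
  proof -
    have "x * z = (\<Sum>j<k. of_rat (c j z) * (x * b j))"
      by (subst expansion[OF that]) (simp add: sum_distrib_left mult.left_commute)
    then have "\<phi> (x * z) = (\<Sum>j<k. of_rat (c j z) * (e * \<phi> (b j)))"
      by (simp add: rat_linear_sum[OF lin] \<phi>_mult_basis)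
    also have "\<dots> = e * \<phi> (\<Sum>j<k. of_rat (c j z) * b j)"
      by (simp add: rat_linear_sum[OF lin] sum_distrib_left mult.left_commute)
    finally show ?thesis
      using expansion[OF that] by simp
  qed
  moreover have "\<exists>z\<in>K. \<phi> z \<noteq> 0"
  proof -
    have "\<exists>j<k. v $ j \<noteq> 0"
    proof (rule ccontr)
      assume "\<not> (\<exists>j<k. v $ j \<noteq> 0)"
      then have "v = 0\<^sub>v k"
        using v(1) by (intro eq_vecI) auto
      then show False
        using v(2) by blast
    qed
    then show ?thesis
      using \<phi>_basis basis_in by metis
  qed
  ultimately show thesis
    using embedding_of_eigenfunctional[OF number_field lin _ assms(1)] that by blast
qed

text \<open>Every eigenvalue of \<open>mult_mat x\<close> is the image of \<open>x\<close> under a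
  complex embedding, and such images are real.\<close>

lemma trace_square_nonneg:
  assumes "totally_real_number_field K" "x \<in> K"
  shows "0 \<le> trace (x\<^sup>2)"
proof -
  have "e \<in> \<real>" if e: "eigenvalue (mult_mat x) e" for e
  proof -
    obtain \<sigma> where "complex_embedding K \<sigma>" "\<sigma> x = e"
      using embedding_of_eigenvalue[OF assms(2) e] .
    then show ?thesis
      using assms unfolding totally_real_number_field_def by blast
  qed
  then have "0 \<le> Re (of_rat (trace (x\<^sup>2)))"
    unfolding of_rat_trace_square[OF assms(2)]
    by (rule mat_trace_square_nonneg[OF mult_mat_carrier])
  then show ?thesis
    by (cases "trace (x\<^sup>2)") (simp add: of_rat_rat Rat.zero_le_Fract_iff Re_divide_of_real zero_le_divide_iff)
qed

end

text \<open>A basis of \<open>K\<close> is extended to one of the ambient field. Coordinates in the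
  larger basis are linear everywhere and agree on \<open>K\<close> with those in the smaller
  one.\<close>

lemma number_field_basis_exists:
  assumes "is_number_field K"
  obtains b c where "number_field_basis K (rat_vec.dim K) b c"
proof -
  obtain B where B: "B \<subseteq> K" "rat_vec.independent B" "K \<subseteq> rat_vec.span B" "card B = rat_vec.dim K"
    using rat_vec.basis_exists .
  obtain S where S: "finite S" "rat_vec.span S = K"
    using assms unfolding is_number_field_def by blast
  then have "finite B"
    using rat_vec.independent_span_bound[OF S(1) B(2)] B(1) by blast
  then obtain b where b: "bij_betw b {..<rat_vec.dim K} B"
    using B(4) by (metis atLeast0LessThan ex_bij_betw_nat_finite)
  let ?E = "rat_vec.extend_basis B"
  let ?c = "\<lambda>j x. rat_vec.representation ?E x (b j)"
  have E: "rat_vec.independent ?E" "rat_vec.span ?E = UNIV" "B \<subseteq> ?E"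
    using B(2) by (auto simp: rat_vec.independent_extend_basis rat_vec.extend_basis_superset)
  have "number_field_basis K (rat_vec.dim K) b ?c"
  proof
    show "is_number_field K" by fact
    show "b j \<in> K" if "j < rat_vec.dim K" for j
      using that b B(1) by (auto simp: bij_betw_def)
    show "?c j (x + y) = ?c j x + ?c j y" for j x y
      using E by (simp add: rat_vec.representation_add)
    show "?c j (of_rat q * x) = q * ?c j x" for j q x
      using E by (simp add: rat_vec.representation_scale)
    show "?c i (b j) = (if i = j then 1 else 0)" if "i < rat_vec.dim K" "j < rat_vec.dim K" for i j
    proof -
      have "b j \<in> ?E"
        using that b E(3) by (auto simp: bij_betw_def)
      moreover have "b i = b j \<longleftrightarrow> i = j"
        using that b by (auto simp: bij_betw_def inj_on_def)
      ultimately show ?thesis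
        using E by (simp add: rat_vec.representation_basis)
    qed
    fix x assume "x \<in> K"
    then have "rat_vec.representation ?E x = rat_vec.representation B x"
      using B(3) E by (intro rat_vec.representation_extend) auto
    then have "(\<Sum>v\<in>B. of_rat (rat_vec.representation ?E x v) * v) = x"
      using rat_vec.sum_representation_eq[OF B(2), of x B] \<open>x \<in> K\<close> B(3) \<open>finite B\<close> by auto
    then show "x = (\<Sum>j<rat_vec.dim K. of_rat (?c j x) * b j)"
      using sum.reindex_bij_betw[OF b, of "\<lambda>v. of_rat (rat_vec.representation ?E x v) * v"] by simp
  qed
  then show thesis by (rule that)
qed

section \<open>Descent of sums of squares\<close>

text \<open>\<open>Poly_Mapping.map\<close> keeps zero coefficients at zero, so it is
  coefficientwise application of \<open>h\<close> once \<open>h\<close> fixes 0.\<close>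

lemma lookup_map_of_zero:
  assumes "h 0 = 0"
  shows "Poly_Mapping.lookup (Poly_Mapping.map h p) t = h (Poly_Mapping.lookup p t)"
  using assms by (simp add: Poly_Mapping.map.rep_eq when_def)

lemma map_in_polys_in:
  assumes "h 0 = 0" "p \<in> polys_in n R"
  shows "Poly_Mapping.map h p \<in> polys_in n UNIV"
proof -
  have "Poly_Mapping.keys (Poly_Mapping.map h p) \<subseteq> Poly_Mapping.keys p"
    using assms(1) by (auto simp: in_keys_iff lookup_map_of_zero)
  then show ?thesis
    using assms(2) unfolding polys_in_def by blast
qed

text \<open>The monomial \<open>0\<close> has all exponents zero, so
  \<open>Poly_Mapping.single 0 a\<close> is the constant polynomial \<open>a\<close>.\<close>

lemma single_zero_mult_in_polys_in:
  fixes p :: "(nat \<Rightarrow>\<^sub>0 nat) \<Rightarrow>\<^sub>0 'a::comm_ring_1"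
  assumes "p \<in> polys_in n UNIV"
  shows "Poly_Mapping.single 0 a * p \<in> polys_in n UNIV"
  unfolding mult_map_scale_conv_mult[symmetric] using assms by (intro map_in_polys_in) auto

lemma lookup_single_zero_mult:
  fixes p :: "(nat \<Rightarrow>\<^sub>0 nat) \<Rightarrow>\<^sub>0 'a::comm_ring_1"
  shows "Poly_Mapping.lookup (Poly_Mapping.single 0 a * p) t = a * Poly_Mapping.lookup p t"
  unfolding mult_map_scale_conv_mult[symmetric] by (simp add: lookup_map_of_zero)

lemma sum_in_polys_in:
  assumes "\<And>i. i \<in> I \<Longrightarrow> g i \<in> polys_in n UNIV"
  shows "sum g I \<in> polys_in n UNIV"
  using keys_sum[of g I] assms unfolding polys_in_def by fastforce

lemma poly_mapping_sum_singles:
  "p = (\<Sum>t\<in>Poly_Mapping.keys p. Poly_Mapping.single t (Poly_Mapping.lookup p t))"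
  by (rule poly_mapping_eqI) (auto simp: lookup_sum lookup_single when_def in_keys_iff)

lemma lookup_rat_poly_to:
  "Poly_Mapping.lookup (rat_poly_to p) t = of_rat (Poly_Mapping.lookup p t)"
  unfolding rat_poly_to_def by (simp add: lookup_map_of_zero)

lemma rat_poly_to_sum: "rat_poly_to (sum g I) = (\<Sum>i\<in>I. rat_poly_to (g i))"
  by (rule poly_mapping_eqI) (simp add: lookup_rat_poly_to lookup_sum of_rat_sum)

text \<open>Writing both factors as sums of monomials reduces the claim to products of single
  terms.\<close>

lemma rat_poly_to_mult:
  "(rat_poly_to (p * q) :: (nat \<Rightarrow>\<^sub>0 nat) \<Rightarrow>\<^sub>0 'a::field_char_0) = rat_poly_to p * rat_poly_to q"
proof -
  have single: "(rat_poly_to (Poly_Mapping.single t a) :: (nat \<Rightarrow>\<^sub>0 nat) \<Rightarrow>\<^sub>0 'a) =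
      Poly_Mapping.single t (of_rat a)" for t a
    unfolding rat_poly_to_def by simp
  let ?s = "\<lambda>p t. Poly_Mapping.single t (Poly_Mapping.lookup p t)"
  let ?p = "\<Sum>t\<in>Poly_Mapping.keys p. ?s p t" and ?q = "\<Sum>t\<in>Poly_Mapping.keys q. ?s q t"
  have "(rat_poly_to (?p * ?q) :: (nat \<Rightarrow>\<^sub>0 nat) \<Rightarrow>\<^sub>0 'a) = rat_poly_to ?p * rat_poly_to ?q"
    by (simp only: sum_product rat_poly_to_sum mult_single single of_rat_mult)
  then show ?thesis
    by (simp only: poly_mapping_sum_singles[symmetric])
qed

section \<open>Closure properties of sums of squares\<close>

lemma sum_of_squares_in_add:
  assumes "sum_of_squares_in A M f" "sum_of_squares_in A N g"
  shows "sum_of_squares_in A (M + N) (f + g)"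
proof -
  obtain p q where p: "\<forall>i\<in>{1..M}. p i \<in> A" "f = (\<Sum>i=1..M. (p i)\<^sup>2)"
    and q: "\<forall>i\<in>{1..N}. q i \<in> A" "g = (\<Sum>i=1..N. (q i)\<^sup>2)"
    using assms unfolding sum_of_squares_in_def by blast
  define r where "r i = (if i \<le> M then p i else q (i - M))" for i
  have "(\<Sum>i=1..M + N. (r i)\<^sup>2) = (\<Sum>i=1..M. (r i)\<^sup>2) + (\<Sum>i=M + 1..M + N. (r i)\<^sup>2)"
    by (rule sum.ub_add_nat) simp
  also have "(\<Sum>i=M + 1..M + N. (r i)\<^sup>2) = (\<Sum>i=1..N. (r (i + M))\<^sup>2)"
    using sum.shift_bounds_cl_nat_ivl[of "\<lambda>i. (r i)\<^sup>2" 1 M N] by (simp add: add.commute)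
  also have "\<dots> = g"
    unfolding q(2) r_def by (intro sum.cong) auto
  also have "(\<Sum>i=1..M. (r i)\<^sup>2) = f"
    unfolding p(2) r_def by (intro sum.cong) auto
  moreover have "r i \<in> A" if "i \<in> {1..M + N}" for i
    using that p(1) q(1)[rule_format, of "i - M"] unfolding r_def
    by (auto simp: Suc_le_eq le_diff_conv)
  ultimately show ?thesis
    unfolding sum_of_squares_in_def by (intro exI[of _ r]) simp
qed

lemma sum_of_squares_in_zero: "0 \<in> A \<Longrightarrow> sum_of_squares_in A N 0"
  unfolding sum_of_squares_in_def by (intro exI[of _ "\<lambda>_. 0"]) simp

lemma sum_of_squares_in_mono:
  assumes "sum_of_squares_in A M f" "M \<le> N" "0 \<in> A"
  shows "sum_of_squares_in A N f"
  using sum_of_squares_in_add[OF assms(1) sum_of_squares_in_zero[OF assms(3), of "N - M"]] assms(2)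
  by simp

lemma sum_of_squares_in_sum:
  assumes "finite I" "\<And>i. i \<in> I \<Longrightarrow> sum_of_squares_in A N (g i)" "0 \<in> A"
  shows "sum_of_squares_in A (card I * N) (sum g I)"
  using assms
  by (induction I rule: finite_induct) (auto simp: sum_of_squares_in_zero intro!: sum_of_squares_in_add)

lemma sum_of_squares_in_square: "p \<in> A \<Longrightarrow> sum_of_squares_in A 1 (p\<^sup>2)"
  unfolding sum_of_squares_in_def by (intro exI[of _ "\<lambda>_. p"]) simp

text \<open>Each of the four constant squares making up \<open>q\<close> is absorbed into the square
  of \<open>p\<close>.\<close>

lemma sum_of_squares_in_four_squares_mult:
  fixes p :: "(nat \<Rightarrow>\<^sub>0 nat) \<Rightarrow>\<^sub>0 'a::comm_ring_1"
  assumes "four_squares q" "p \<in> polys_in n UNIV"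
  shows "sum_of_squares_in (polys_in n UNIV) 4 (Poly_Mapping.single 0 q * p\<^sup>2)"
proof -
  obtain s t u v where q: "q = s\<^sup>2 + t\<^sup>2 + u\<^sup>2 + v\<^sup>2"
    using assms(1) unfolding four_squares_def by blast
  let ?C = "Poly_Mapping.single 0 :: 'a \<Rightarrow> (nat \<Rightarrow>\<^sub>0 nat) \<Rightarrow>\<^sub>0 'a"
  have "?C (x\<^sup>2) = (?C x)\<^sup>2" for x
    by (simp add: power2_eq_square mult_single)
  then have "?C q * p\<^sup>2 = (?C s * p)\<^sup>2 + (?C t * p)\<^sup>2 + (?C u * p)\<^sup>2 + (?C v * p)\<^sup>2"
    unfolding q by (simp add: single_add power_mult_distrib distrib_right)
  moreover have "sum_of_squares_in (polys_in n UNIV) 1 ((?C x * p)\<^sup>2)" for x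
    by (intro sum_of_squares_in_square single_zero_mult_in_polys_in assms(2))
  then have "sum_of_squares_in (polys_in n UNIV) (1 + 1 + 1 + 1)
      ((?C s * p)\<^sup>2 + (?C t * p)\<^sup>2 + (?C u * p)\<^sup>2 + (?C v * p)\<^sup>2)"
    by (intro sum_of_squares_in_add)
  ultimately show ?thesis
    by (simp add: numeral_eq_Suc)
qed

section \<open>Diagonalized trace form and coefficientwise trace\<close>

context number_field_basis
begin

lemma dim_pos: "0 < k"
proof (rule ccontr)
  assume "\<not> 0 < k"
  moreover have "1 \<in> K"
    using subfield by (simp add: is_subfield_def)
  ultimately show False
    using expansion[of 1] by simp
qed

lemma trace_zero: "trace 0 = 0"
  using trace_add[of 0 0] by simp

text \<open>The Gram matrix of the trace form is semidefinite: at \<open>x\<close> its quadratic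
  form is the trace of the square of \<open>\<Sum>i<k. of_rat (x i) * b i\<close>, an element of
  \<open>K\<close>.\<close>

lemma trace_form_diagonalization:
  assumes "totally_real_number_field K"
  obtains a d where "\<And>r. r < k \<Longrightarrow> 0 \<le> a r"
    "\<And>i j. i < k \<Longrightarrow> j < k \<Longrightarrow> trace (b i * b j) = (\<Sum>r<k. a r * d r i * d r j)"
proof -
  have "0 \<le> (\<Sum>i<k. \<Sum>j<k. trace (b i * b j) * x i * x j)" for x
  proof -
    let ?z = "\<Sum>i<k. of_rat (x i) * b i"
    have trace_sum: "trace (\<Sum>i\<in>I. y i) = (\<Sum>i\<in>I. trace (y i))" for I :: "nat set" and y
      by (induction I rule: infinite_finite_induct) (auto simp: trace_zero trace_add)
    have "?z\<^sup>2 = (\<Sum>i<k. \<Sum>j<k. of_rat (x i) * (of_rat (x j) * (b i * b j)))"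
      unfolding power2_eq_square sum_product by (intro sum.cong) (auto simp: mult_ac)
    then have "trace (?z\<^sup>2) = (\<Sum>i<k. \<Sum>j<k. x i * (x j * trace (b i * b j)))"
      by (simp only: trace_sum trace_scale)
    also have "\<dots> = (\<Sum>i<k. \<Sum>j<k. trace (b i * b j) * x i * x j)"
      by (simp add: mult_ac)
    finally have "trace (?z\<^sup>2) = (\<Sum>i<k. \<Sum>j<k. trace (b i * b j) * x i * x j)" .
    moreover have "(\<Sum>i\<in>I. of_rat (x i) * b i) \<in> K" if "I \<subseteq> {..<k}" for I
    proof -
      obtain S where "rat_vec.span S = K"
        using number_field unfolding is_number_field_def by blast
      moreover have "(\<Sum>i\<in>I. of_rat (x i) * b i) \<in> rat_vec.span S"
        using that basis_in calculation
        by (intro rat_vec.span_sum rat_vec.span_scale) auto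
      ultimately show ?thesis by simp
    qed
    ultimately show ?thesis
      using trace_square_nonneg[OF assms, of ?z] by simp
  qed
  moreover have "trace (b i * b j) = trace (b j * b i)" for i j
    by (simp add: mult.commute)
  ultimately have "\<exists>a d. (\<forall>r<k. 0 \<le> a r) \<and>
      (\<forall>i<k. \<forall>j<k. trace (b i * b j) = (\<Sum>r<k. a r * d r i * d r j))"
    by (intro psd_diagonalization)
  then show thesis
    using that by blast
qed

definition poly_trace :: "((nat \<Rightarrow>\<^sub>0 nat) \<Rightarrow>\<^sub>0 'a) \<Rightarrow> ((nat \<Rightarrow>\<^sub>0 nat) \<Rightarrow>\<^sub>0 rat)" where
  "poly_trace p = Poly_Mapping.map trace p"

lemma lookup_poly_trace: "Poly_Mapping.lookup (poly_trace p) t = trace (Poly_Mapping.lookup p t)"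
  unfolding poly_trace_def by (simp add: lookup_map_of_zero trace_zero)

lemma poly_trace_sum: "poly_trace (sum g I) = (\<Sum>i\<in>I. poly_trace (g i))"
proof (rule poly_mapping_eqI)
  show "Poly_Mapping.lookup (poly_trace (sum g I)) t = Poly_Mapping.lookup (\<Sum>i\<in>I. poly_trace (g i)) t" for t
    unfolding lookup_poly_trace lookup_sum
    by (induction I rule: infinite_finite_induct) (auto simp: trace_zero trace_add lookup_poly_trace)
qed

text \<open>The coefficientwise trace is linear over rational polynomials. With \<open>a = 1\<close>
  it multiplies a rational polynomial by \<open>k\<close>.\<close>

lemma poly_trace_scale:
  "poly_trace (Poly_Mapping.single 0 a * rat_poly_to g) = Poly_Mapping.single 0 (trace a) * g"
  by (rule poly_mapping_eqI)
    (simp add: lookup_poly_trace lookup_single_zero_mult lookup_rat_poly_to mult.commute[of a]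
      trace_scale mult.commute[of "trace a"])

lemma poly_trace_rat_poly_to: "poly_trace (rat_poly_to g) = Poly_Mapping.single 0 (of_nat k) * g"
  using poly_trace_scale[of 1 g] by (simp add: trace_one)

text \<open>Expanding coefficients in the basis writes \<open>p\<close> as a combination of the
  \<open>b j\<close> with rational polynomials \<open>q j\<close>. The trace of its square is the
  trace form evaluated at the \<open>q j\<close>, and the diagonalization turns it into weighted
  squares of the linear forms \<open>g r\<close>.\<close>

lemma poly_trace_square:
  assumes d: "\<And>i j. i < k \<Longrightarrow> j < k \<Longrightarrow> trace (b i * b j) = (\<Sum>r<k. a r * d r i * d r j)"
    and p: "p \<in> polys_in n K"
  shows "\<exists>g. (\<forall>r. g r \<in> polys_in n UNIV) \<and>
    poly_trace (p\<^sup>2) = (\<Sum>r<k. Poly_Mapping.single 0 (a r) * (g r)\<^sup>2)"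
proof -
  let ?C = "Poly_Mapping.single 0 :: rat \<Rightarrow> (nat \<Rightarrow>\<^sub>0 nat) \<Rightarrow>\<^sub>0 rat"
  let ?D = "Poly_Mapping.single 0 :: 'a \<Rightarrow> (nat \<Rightarrow>\<^sub>0 nat) \<Rightarrow>\<^sub>0 'a"
  define q where "q j = Poly_Mapping.map (c j) p" for j
  define g where "g r = (\<Sum>i<k. ?C (d r i) * q i)" for r
  have c0: "c j 0 = 0" for j
    using coord_add[of j 0 0] by simp
  have "p = (\<Sum>j<k. ?D (b j) * rat_poly_to (q j))"
  proof (rule poly_mapping_eqI)
    fix t
    have "Poly_Mapping.lookup p t \<in> K"
      using p unfolding polys_in_def by blast
    then have "Poly_Mapping.lookup p t = (\<Sum>j<k. of_rat (c j (Poly_Mapping.lookup p t)) * b j)"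
      by (rule expansion)
    also have "\<dots> = Poly_Mapping.lookup (\<Sum>j<k. ?D (b j) * rat_poly_to (q j)) t"
      by (simp add: lookup_sum lookup_single_zero_mult lookup_rat_poly_to q_def lookup_map_of_zero c0
          mult.commute[of "b _"])
    finally show "Poly_Mapping.lookup p t = Poly_Mapping.lookup (\<Sum>j<k. ?D (b j) * rat_poly_to (q j)) t" .
  qed
  then have "p\<^sup>2 = (\<Sum>i<k. \<Sum>j<k. (?D (b i) * rat_poly_to (q i)) * (?D (b j) * rat_poly_to (q j)))"
    unfolding power2_eq_square sum_product[symmetric] by simp
  also have "\<dots> = (\<Sum>i<k. \<Sum>j<k. ?D (b i * b j) * rat_poly_to (q i * q j))"
  proof (intro sum.cong refl)
    fix i j
    have "?D (b i * b j) = ?D (b i) * ?D (b j)"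
      by (simp add: mult_single)
    then show "(?D (b i) * rat_poly_to (q i)) * (?D (b j) * rat_poly_to (q j)) =
        ?D (b i * b j) * rat_poly_to (q i * q j)"
      by (simp only: rat_poly_to_mult mult_ac)
  qed
  finally have "poly_trace (p\<^sup>2) = (\<Sum>i<k. \<Sum>j<k. ?C (trace (b i * b j)) * (q i * q j))"
    by (simp only: poly_trace_sum poly_trace_scale)
  also have "\<dots> = (\<Sum>i<k. \<Sum>j<k. \<Sum>r<k. ?C (a r) * ((?C (d r i) * q i) * (?C (d r j) * q j)))"
  proof (intro sum.cong refl)
    fix i j assume "i \<in> {..<k}" "j \<in> {..<k}"
    have C_sum: "?C (sum y I) = (\<Sum>r\<in>I. ?C (y r))" for y and I :: "nat set"
      by (induction I rule: infinite_finite_induct) (auto simp: single_add)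
    have C_mult: "?C (x * y) = ?C x * ?C y" for x y
      by (simp add: mult_single)
    show "?C (trace (b i * b j)) * (q i * q j) =
        (\<Sum>r<k. ?C (a r) * ((?C (d r i) * q i) * (?C (d r j) * q j)))"
      using \<open>i \<in> {..<k}\<close> \<open>j \<in> {..<k}\<close>
      by (simp only: d lessThan_iff C_sum C_mult sum_distrib_right) (simp only: mult_ac)
  qed
  also have "\<dots> = (\<Sum>i<k. \<Sum>r<k. \<Sum>j<k. ?C (a r) * ((?C (d r i) * q i) * (?C (d r j) * q j)))"
    by (intro sum.cong refl sum.swap)
  also have "\<dots> = (\<Sum>r<k. \<Sum>i<k. \<Sum>j<k. ?C (a r) * ((?C (d r i) * q i) * (?C (d r j) * q j)))"
    by (rule sum.swap)
  also have "\<dots> = (\<Sum>r<k. ?C (a r) * (g r)\<^sup>2)"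
    unfolding g_def power2_eq_square sum_product by (simp only: sum_distrib_left)
  finally have "poly_trace (p\<^sup>2) = (\<Sum>r<k. ?C (a r) * (g r)\<^sup>2)" .
  moreover have "g r \<in> polys_in n UNIV" for r
    unfolding g_def q_def
    by (intro sum_in_polys_in single_zero_mult_in_polys_in map_in_polys_in[of "c _", OF c0 p])
  ultimately show ?thesis by blast
qed

text \<open>The count: each of the \<open>m\<close> squares yields \<open>k\<close> weighted
  squares, and each nonnegative rational weight costs four.\<close>

lemma sum_of_squares_descent:
  assumes real: "totally_real_number_field K"
    and f: "sum_of_squares_in (polys_in n K) m (rat_poly_to f)"
  shows "sum_of_squares_in (polys_in n UNIV) (m * (k * 4)) f"
proof -
  let ?C = "Poly_Mapping.single 0 :: rat \<Rightarrow> (nat \<Rightarrow>\<^sub>0 nat) \<Rightarrow>\<^sub>0 rat"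
  obtain p where p: "\<forall>l\<in>{1..m}. p l \<in> polys_in n K" "rat_poly_to f = (\<Sum>l=1..m. (p l)\<^sup>2)"
    using f unfolding sum_of_squares_in_def by blast
  obtain a d where a: "\<And>r. r < k \<Longrightarrow> 0 \<le> a r"
    and d: "\<And>i j. i < k \<Longrightarrow> j < k \<Longrightarrow> trace (b i * b j) = (\<Sum>r<k. a r * d r i * d r j)"
    using trace_form_diagonalization[OF real] by blast
  have "\<forall>l\<in>{1..m}. \<exists>g. (\<forall>r. g r \<in> polys_in n UNIV) \<and>
      poly_trace ((p l)\<^sup>2) = (\<Sum>r<k. ?C (a r) * (g r)\<^sup>2)"
  proof
    fix l assume "l \<in> {1..m}"
    then have "p l \<in> polys_in n K"
      using p(1) by blast
    then show "\<exists>g. (\<forall>r. g r \<in> polys_in n UNIV) \<and>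
        poly_trace ((p l)\<^sup>2) = (\<Sum>r<k. ?C (a r) * (g r)\<^sup>2)"
      by (intro poly_trace_square[where a = a and d = d] d)
  qed
  then obtain g where g: "\<forall>l\<in>{1..m}. (\<forall>r. g l r \<in> polys_in n UNIV) \<and>
      poly_trace ((p l)\<^sup>2) = (\<Sum>r<k. ?C (a r) * (g l r)\<^sup>2)"
    by (rule bchoice[THEN exE])
  have C_mult: "?C (x * y) = ?C x * ?C y" for x y
    by (simp add: mult_single)
  have "f = ?C (1 / of_nat k) * (?C (of_nat k) * f)"
  proof -
    have "f = ?C (1 / of_nat k * of_nat k) * f"
      using dim_pos by simp
    then show ?thesis
      by (simp only: C_mult mult.assoc)
  qed
  also have "?C (of_nat k) * f = (\<Sum>l=1..m. poly_trace ((p l)\<^sup>2))"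
    by (simp only: poly_trace_rat_poly_to[symmetric] p(2) poly_trace_sum)
  also have "\<dots> = (\<Sum>l=1..m. \<Sum>r<k. ?C (a r) * (g l r)\<^sup>2)"
    using g by (intro sum.cong) auto
  \<comment> \<open>The division by \<open>k\<close> is merged into the weights, which stay
    nonnegative, so it adds no squares.\<close>
  also have "?C (1 / of_nat k) * \<dots> = (\<Sum>l=1..m. \<Sum>r<k. ?C (1 / of_nat k * a r) * (g l r)\<^sup>2)"
    by (simp only: sum_distrib_left C_mult mult.assoc)
  finally have "f = (\<Sum>l=1..m. \<Sum>r<k. ?C (1 / of_nat k * a r) * (g l r)\<^sup>2)" .
  moreover have "(0 :: (nat \<Rightarrow>\<^sub>0 nat) \<Rightarrow>\<^sub>0 rat) \<in> polys_in n UNIV"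
    by (simp add: polys_in_def)
  then have "sum_of_squares_in (polys_in n UNIV) (card {1..m} * (card {..<k} * 4))
      (\<Sum>l=1..m. \<Sum>r<k. ?C (1 / of_nat k * a r) * (g l r)\<^sup>2)"
    using g(1) a
    by (intro sum_of_squares_in_sum sum_of_squares_in_four_squares_mult four_squares_rat) auto
  ultimately show ?thesis by simp
qed

end

text \<open>A basis of \<open>K\<close> is independent inside the span of a basis of
  \<open>L\<close>. Since \<open>L\<close> is a number field, that basis is finite and its
  cardinality is a genuine bound.\<close>

lemma degree_over_rat_mono:
  assumes "is_number_field L" "K \<subseteq> L"
  shows "degree_over_rat K \<le> degree_over_rat L"
proof -
  obtain B where B: "B \<subseteq> K" "rat_vec.independent B" "card B = rat_vec.dim K"
    using rat_vec.basis_exists .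
  obtain C where C: "C \<subseteq> L" "rat_vec.independent C" "L \<subseteq> rat_vec.span C" "card C = rat_vec.dim L"
    using rat_vec.basis_exists .
  obtain S where S: "finite S" "rat_vec.span S = L"
    using assms(1) unfolding is_number_field_def by blast
  have "finite C"
    using rat_vec.independent_span_bound[OF S(1) C(2)] S(2) C(1) by blast
  then have "card B \<le> card C"
    using rat_vec.independent_span_bound[OF _ B(2), of C] B(1) C(3) assms(2) by blast
  then show ?thesis
    unfolding degree_over_rat_def using B(3) C(4) by simp
qed

theorem theorem1p4:
  fixes K L :: "'a::field_char_0 set"
    and n m :: nat
    and f :: "(nat \<Rightarrow>\<^sub>0 nat) \<Rightarrow>\<^sub>0 rat"
  assumes "totally_real_number_field K"
    and "is_galois_closure K L"
    and "f \<in> polys_in n UNIV"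
    and "sum_of_squares_in (polys_in n K) m (rat_poly_to f)"
  shows "sum_of_squares_in (polys_in n UNIV)
           (4 * m * 2 ^ (degree_over_rat L + 1) * ((degree_over_rat L + 1) choose 2)) f"
proof -
  let ?k = "degree_over_rat K" and ?d = "degree_over_rat L"
  have "is_number_field K"
    using assms(1) unfolding totally_real_number_field_def by blast
  then obtain b c where "number_field_basis K ?k b c"
    unfolding degree_over_rat_def by (rule number_field_basis_exists)
  then have "sum_of_squares_in (polys_in n UNIV) (m * (?k * 4)) f"
    using assms(1,4) by (rule number_field_basis.sum_of_squares_descent)
  moreover have "m * (?k * 4) \<le> 4 * m * 2 ^ (?d + 1) * ((?d + 1) choose 2)"
  proof -
    have "?k \<le> ?d"
      using assms(2) unfolding is_galois_closure_def is_galois_over_rat_def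
      by (intro degree_over_rat_mono) auto
    \<comment> \<open>Pascal's rule writes the right side as
      \<open>?d + (?d choose 2)\<close>.\<close>
    also have "?d \<le> (?d + 1) choose 2"
      by (simp add: numeral_2_eq_2)
    also have "\<dots> \<le> 2 ^ (?d + 1) * ((?d + 1) choose 2)"
      by simp
    finally show ?thesis
      using mult_le_mono2[of ?k _ "4 * m"] by (simp add: mult_ac)
  qed
  moreover have "(0 :: (nat \<Rightarrow>\<^sub>0 nat) \<Rightarrow>\<^sub>0 rat) \<in> polys_in n UNIV"
    by (simp add: polys_in_def)
  ultimately show ?thesis
    by (rule sum_of_squares_in_mono)
qed

end
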